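(* Let $f:[a,b]\to\mathbb{R}$ be an absolutely continuous mapping. Define the kernel $P(x,\cdot):[a,b]\to\mathbb{R}$ by $$P(x,t)=\begin{cases}\dfrac{\alpha}{\alpha+\beta}\,\dfrac{1}{x-a}\,\dfrac12\left[t-\left(a+h\frac{b-a}{2}\right)\right]^2, & a\le t\le x,\\[2mm] \dfrac{\beta}{\alpha+\beta}\,\dfrac{1}{b-x}\,\dfrac12\left[t-\left(b-h\frac{b-a}{2}\right)\right]^2, & x<t\le b,\end{cases}$$ for all $x\in\left[a+h\frac{b-a}{2},\,b-h\frac{b-a}{2}\right]$ and $h\in[0,1]$, where $\alpha,\beta\in\mathbb{R}$ are nonnegative and not both zero. Then the following identity holds: $$\begin{aligned}\int_a^b P(x,t)f''(t)\,dt={}&\frac{1}{2(\alpha+\beta)}\left[\frac{\alpha}{x-a}\left(x-\left(a+h\tfrac{b-a}{2}\right)\right)^2-\frac{\beta}{b-x}\left(x-\left(b-h\tfrac{b-a}{2}\right)\right)^2\right]f'(x)\\&-\frac{1}{\alpha+\beta}\left[\frac{\alpha}{x-a}\left(x-\left(a+h\tfrac{b-a}{2}\right)\right)-\frac{\beta}{b-x}\left(x-\left(b-h\tfrac{b-a}{2}\right)\right)\right]f(x)\\&-\frac{1}{\alpha+\beta}\,h\,\frac{b-a}{2}\left[\frac{\alpha}{x-a}f(a)+\frac{\beta}{b-x}f(b)\right]\\&+\frac{1}{\alpha+\beta}\,h^2\,\frac{(b-a)^2}{8}\left[\frac{\beta}{b-x}f'(b)-\frac{\alpha}{x-a}f'(a)\right]\\&+\frac{1}{\alpha+\beta}\left[\frac{\alpha}{x-a}\int_a^x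 f(t)\,dt+\frac{\beta}{b-x}\int_x^b f(t)\,dt\right].\end{aligned}$$
   Context: Here $[a,b]$ is a real interval with $a<b$, and $f'$, $f''$ denote the first and second derivatives of $f$.
   Formalization: Absolute continuity of f alone does not suffice (f an antiderivative of the Cantor function is a counterexample); it is assumed in addition that f is differentiable on [a,b], f' is absolutely continuous, and f'' is the derivative of f' almost everywhere. *)

theory Defs
  imports "HOL-Analysis.Analysis"
begin

text \<open>
  Absolute continuity of a real function on an interval (the library's
  \<open>absolutely_continuous\<close> is the relation between measures). A \<open>division_of\<close> is a finite
  set of nonempty compact intervals with pairwise disjoint interiors, so \<open>D\<close> ranges over
  all finite families of nonoverlapping intervals \<open>{u..v}\<close> contained in \<open>{a..b}\<close>.
\<close>

definition absolutely_continuous_on_interval :: "real \<Rightarrow> real \<Rightarrow> (real \<Rightarrow> real) \<Rightarrow> bool"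
  where "absolutely_continuous_on_interval a b f \<longleftrightarrow>
    (\<forall>\<epsilon>>0. \<exists>\<delta>>0. \<forall>D. D division_of \<Union>D \<longrightarrow> \<Union>D \<subseteq> {a..b} \<longrightarrow>
       (\<Sum>K\<in>D. Sup K - Inf K) < \<delta> \<longrightarrow> (\<Sum>K\<in>D. \<bar>f (Sup K) - f (Inf K)\<bar>) < \<epsilon>)"

text \<open>
  Only the values at \<open>t \<in> {a..b}\<close> matter. The case \<open>x = a\<close> (or \<open>x = b\<close>), which is possible
  only for \<open>h = 0\<close>, falls under the convention \<open>1 / 0 = 0\<close>.
\<close>

definition peano_kernel ::
    "real \<Rightarrow> real \<Rightarrow> real \<Rightarrow> real \<Rightarrow> real \<Rightarrow> real \<Rightarrow> real \<Rightarrow> real"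
  where "peano_kernel a b \<alpha> \<beta> h x t =
    (if t \<le> x
     then \<alpha> / (\<alpha> + \<beta>) * (1 / (x - a)) * (1 / 2) * (t - (a + h * ((b - a) / 2)))\<^sup>2
     else \<beta> / (\<alpha> + \<beta>) * (1 / (b - x)) * (1 / 2) * (t - (b - h * ((b - a) / 2)))\<^sup>2)"

end

theory Submission
  imports Defs
begin

text \<open>
  The core is the fundamental theorem of calculus for absolutely continuous functions, proved
  with gauges: on the exceptional null set the gauge is confined to an open set of small measure,
  so that absolute continuity controls the increments there, and elsewhere it comes from
  differentiability. Absolute continuity bounds the variation over short intervals, which makes
  the derivative absolutely integrable. The identity follows by applying this theorem
  to \<open>(t - c)\<^sup>2 * f' t\<close> on each side of \<open>x\<close>, followed by an ordinary integration by parts.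
\<close>

section \<open>Absolute continuity on an interval and its closure properties\<close>

lemma absolutely_continuous_on_intervalD:
  assumes "absolutely_continuous_on_interval a b g" "0 < e"
  obtains d where "0 < d"
    "\<And>D. D division_of \<Union>D \<Longrightarrow> \<Union>D \<subseteq> {a..b} \<Longrightarrow> (\<Sum>K\<in>D. Sup K - Inf K) < d
       \<Longrightarrow> (\<Sum>K\<in>D. \<bar>g (Sup K) - g (Inf K)\<bar>) < e"
proof -
  from assms obtain d where "0 < d" "\<forall>D. D division_of \<Union>D \<longrightarrow> \<Union>D \<subseteq> {a..b} \<longrightarrow>
      (\<Sum>K\<in>D. Sup K - Inf K) < d \<longrightarrow> (\<Sum>K\<in>D. \<bar>g (Sup K) - g (Inf K)\<bar>) < e"
    unfolding absolutely_continuous_on_interval_def by blast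
  then show thesis using that by simp
qed

lemma absolutely_continuous_on_interval_subset:
  assumes "absolutely_continuous_on_interval a b g" "{u..v} \<subseteq> {a..b}"
  shows "absolutely_continuous_on_interval u v g"
  using assms unfolding absolutely_continuous_on_interval_def by (meson subset_trans)

text \<open>A single interval between two points is already an admissible family, so the
  \<open>d\<close> of the definition serves as a modulus of continuity, the same at every
  point.\<close>

lemma absolutely_continuous_on_interval_imp_continuous_on:
  fixes g :: "real \<Rightarrow> real"
  assumes "absolutely_continuous_on_interval a b g"
  shows "continuous_on {a..b} g"
  unfolding continuous_on_iff
proof (intro ballI allI impI)
  fix s e :: real
  assume s: "s \<in> {a..b}" and "0 < e"
  obtain d where "0 < d" and d: "\<And>D. D division_of \<Union>D \<Longrightarrow> \<Union>D \<subseteq> {a..b}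
      \<Longrightarrow> (\<Sum>K\<in>D. Sup K - Inf K) < d \<Longrightarrow> (\<Sum>K\<in>D. \<bar>g (Sup K) - g (Inf K)\<bar>) < e"
    using absolutely_continuous_on_intervalD[OF assms \<open>0 < e\<close>] by blast
  have small: "\<bar>g v - g u\<bar> < e" if "u \<le> v" "v - u < d" "u \<in> {a..b}" "v \<in> {a..b}" for u v
  proof -
    have "{{u..v}} division_of \<Union>{{u..v}}"
      using division_of_self[of u v] that by simp
    then show ?thesis
      using d[of "{{u..v}}"] that by auto
  qed
  show "\<exists>d>0. \<forall>t\<in>{a..b}. dist t s < d \<longrightarrow> dist (g t) (g s) < e"
  proof (intro exI conjI ballI impI)
    fix t assume "t \<in> {a..b}" "dist t s < d"
    then show "dist (g t) (g s) < e"
      using small[of s t] small[of t s] s by (cases "s \<le> t") (auto simp: dist_real_def)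
  qed (rule \<open>0 < d\<close>)
qed

text \<open>Turns the \<open>Inf\<close> and \<open>Sup\<close> of the definition into genuine
  endpoints that lie in the divided set. This rests on members of a division being nonempty compact
  intervals.\<close>

lemma division_of_real_interval_cases:
  fixes D :: "real set set"
  assumes "D division_of S" "K \<in> D"
  obtains u v where "u \<le> v" "K = {u..v}" "Inf K = u" "Sup K = v" "u \<in> S" "v \<in> S"
proof -
  obtain u v where K: "K = {u..v}" "K \<noteq> {}" "K \<subseteq> S"
    using division_ofD[OF assms(1)] assms(2) by (metis box_real(2))
  then have "u \<le> v" by simp
  with K have "u \<in> S" "v \<in> S" by auto
  with K \<open>u \<le> v\<close> that show thesis by simp
qed

lemma content_division_of_real_interval:
  fixes D :: "real set set"
  assumes "D division_of S" "K \<in> D"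
  shows "measure lborel K = Sup K - Inf K" "measure lebesgue K = Sup K - Inf K" "Inf K \<le> Sup K"
  by (rule division_of_real_interval_cases[OF assms], simp)+

text \<open>Both factors are continuous on a compact interval, hence bounded by a common
  \<open>M\<close>. Splitting the increment as \<open>p v * (q v - q u) + q u * (p v - p u)\<close>
  bounds its sum over a family by \<open>M\<close> times the sums for \<open>p\<close> and
  \<open>q\<close>, each below \<open>e / (2 * M)\<close>.\<close>

lemma absolutely_continuous_on_interval_mult:
  fixes p q :: "real \<Rightarrow> real"
  assumes p: "absolutely_continuous_on_interval a b p"
    and q: "absolutely_continuous_on_interval a b q"
  shows "absolutely_continuous_on_interval a b (\<lambda>t. p t * q t)"
  unfolding absolutely_continuous_on_interval_def
proof (intro allI impI)
  fix e :: real assume "0 < e"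
  have bound: "\<exists>M. \<forall>t\<in>{a..b}. \<bar>g t\<bar> \<le> M" if "continuous_on {a..b} g" for g :: "real \<Rightarrow> real"
    using compact_imp_bounded[OF compact_continuous_image[OF that compact_Icc]]
    by (auto simp: bounded_iff)
  obtain M1 M2 where "\<And>t. t \<in> {a..b} \<Longrightarrow> \<bar>p t\<bar> \<le> M1" "\<And>t. t \<in> {a..b} \<Longrightarrow> \<bar>q t\<bar> \<le> M2"
    using bound p q absolutely_continuous_on_interval_imp_continuous_on by metis
  \<comment> \<open>The 1 keeps \<open>M\<close> positive, so that \<open>e / (2 * M)\<close> is a
    valid tolerance whatever the two bounds are.\<close>
  moreover define M where "M = max 1 (max M1 M2)"
  ultimately have M: "\<And>t. t \<in> {a..b} \<Longrightarrow> \<bar>p t\<bar> \<le> M \<and> \<bar>q t\<bar> \<le> M" and "0 < M"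
    by (force simp: M_def)+
  have "0 < e / (2 * M)" using \<open>0 < e\<close> \<open>0 < M\<close> by simp
  obtain dp where "0 < dp" and dp: "\<And>D. D division_of \<Union>D \<Longrightarrow> \<Union>D \<subseteq> {a..b}
      \<Longrightarrow> (\<Sum>K\<in>D. Sup K - Inf K) < dp \<Longrightarrow> (\<Sum>K\<in>D. \<bar>p (Sup K) - p (Inf K)\<bar>) < e / (2 * M)"
    using absolutely_continuous_on_intervalD[OF p \<open>0 < e / (2 * M)\<close>] by blast
  obtain dq where "0 < dq" and dq: "\<And>D. D division_of \<Union>D \<Longrightarrow> \<Union>D \<subseteq> {a..b}
      \<Longrightarrow> (\<Sum>K\<in>D. Sup K - Inf K) < dq \<Longrightarrow> (\<Sum>K\<in>D. \<bar>q (Sup K) - q (Inf K)\<bar>) < e / (2 * M)"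
    using absolutely_continuous_on_intervalD[OF q \<open>0 < e / (2 * M)\<close>] by blast
  show "\<exists>\<delta>>0. \<forall>D. D division_of \<Union>D \<longrightarrow> \<Union>D \<subseteq> {a..b} \<longrightarrow> (\<Sum>K\<in>D. Sup K - Inf K) < \<delta> \<longrightarrow>
      (\<Sum>K\<in>D. \<bar>p (Sup K) * q (Sup K) - p (Inf K) * q (Inf K)\<bar>) < e"
  proof (intro exI[of _ "min dp dq"] conjI allI impI)
    fix D assume D: "D division_of \<Union>D" "\<Union>D \<subseteq> {a..b}" "(\<Sum>K\<in>D. Sup K - Inf K) < min dp dq"
    have "(\<Sum>K\<in>D. \<bar>p (Sup K) * q (Sup K) - p (Inf K) * q (Inf K)\<bar>)
        \<le> (\<Sum>K\<in>D. M * \<bar>q (Sup K) - q (Inf K)\<bar> + M * \<bar>p (Sup K) - p (Inf K)\<bar>)"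
    proof (rule sum_mono)
      fix K assume "K \<in> D"
      then obtain u v where K: "Inf K = u" "Sup K = v" "u \<in> {a..b}" "v \<in> {a..b}"
        using division_of_real_interval_cases[OF D(1)] D(2) by (metis subsetD)
      have "p v * q v - p u * q u = p v * (q v - q u) + q u * (p v - p u)"
        by (simp add: algebra_simps)
      also have "\<bar>\<dots>\<bar> \<le> \<bar>p v\<bar> * \<bar>q v - q u\<bar> + \<bar>q u\<bar> * \<bar>p v - p u\<bar>"
        by (metis abs_mult abs_triangle_ineq)
      also have "\<dots> \<le> M * \<bar>q v - q u\<bar> + M * \<bar>p v - p u\<bar>"
        using M K by (intro add_mono mult_right_mono) auto
      finally show "\<bar>p (Sup K) * q (Sup K) - p (Inf K) * q (Inf K)\<bar>
          \<le> M * \<bar>q (Sup K) - q (Inf K)\<bar> + M * \<bar>p (Sup K) - p (Inf K)\<bar>"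
        by (simp add: K)
    qed
    also have "\<dots> = M * (\<Sum>K\<in>D. \<bar>q (Sup K) - q (Inf K)\<bar>) + M * (\<Sum>K\<in>D. \<bar>p (Sup K) - p (Inf K)\<bar>)"
      by (simp add: sum.distrib sum_distrib_left)
    also have "\<dots> < M * (e / (2 * M)) + M * (e / (2 * M))"
      using dp[OF D(1,2)] dq[OF D(1,2)] D(3) \<open>0 < M\<close>
      by (intro add_strict_mono mult_strict_left_mono) auto
    also have "\<dots> = e" using \<open>0 < M\<close> by simp
    finally show "(\<Sum>K\<in>D. \<bar>p (Sup K) * q (Sup K) - p (Inf K) * q (Inf K)\<bar>) < e" .
  qed (use \<open>0 < dp\<close> \<open>0 < dq\<close> in auto)
qed

text \<open>The increments are exactly the lengths, so the tolerance itself can be taken for the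
  \<open>\<delta>\<close> of the definition. Used for the two linear factors of the kernel's
  square.\<close>

lemma absolutely_continuous_on_interval_shift: "absolutely_continuous_on_interval a b (\<lambda>t. t - c)"
  unfolding absolutely_continuous_on_interval_def
proof (intro allI impI)
  fix e :: real assume "0 < e"
  have "(\<Sum>K\<in>D. \<bar>(Sup K - c) - (Inf K - c)\<bar>) = (\<Sum>K\<in>D. Sup K - Inf K)"
    if "D division_of \<Union>D" for D :: "real set set"
    by (rule sum.cong) (simp_all add: content_division_of_real_interval[OF that])
  then show "\<exists>\<delta>>0. \<forall>D. D division_of \<Union>D \<longrightarrow> \<Union>D \<subseteq> {a..b} \<longrightarrow> (\<Sum>K\<in>D. Sup K - Inf K) < \<delta> \<longrightarrow>
      (\<Sum>K\<in>D. \<bar>(Sup K - c) - (Inf K - c)\<bar>) < e"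
    using \<open>0 < e\<close> by auto
qed

section \<open>The fundamental theorem of calculus for absolutely continuous functions\<close>

text \<open>A tag may lie anywhere in its interval, so the derivative estimate is applied from
  \<open>t\<close> to each endpoint separately. The two errors add up to \<open>e * (v - u)\<close>
  because \<open>t\<close> lies between \<open>u\<close> and \<open>v\<close>.\<close>

lemma has_real_derivative_straddle:
  fixes g :: "real \<Rightarrow> real"
  assumes "(g has_real_derivative m) (at t within S)" "0 < e"
  obtains d where "0 < d"
    "\<And>u v. u \<in> S \<Longrightarrow> v \<in> S \<Longrightarrow> u \<le> t \<Longrightarrow> t \<le> v \<Longrightarrow> t - u < d \<Longrightarrow> v - t < d
       \<Longrightarrow> \<bar>(v - u) * m - (g v - g u)\<bar> \<le> e * (v - u)"
proof -
  obtain d where "0 < d"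
    and d: "\<And>y. y \<in> S \<Longrightarrow> \<bar>y - t\<bar> < d \<Longrightarrow> \<bar>g y - g t - m * (y - t)\<bar> \<le> e * \<bar>y - t\<bar>"
    using assms unfolding has_field_derivative_def has_derivative_within_alt
    by (metis real_norm_def)
  have "\<bar>(v - u) * m - (g v - g u)\<bar> \<le> e * (v - u)"
    if "u \<in> S" "v \<in> S" "u \<le> t" "t \<le> v" "t - u < d" "v - t < d" for u v
  proof -
    have "(v - u) * m - (g v - g u) = (g u - g t - m * (u - t)) - (g v - g t - m * (v - t))"
      by (simp add: algebra_simps)
    also have "\<bar>\<dots>\<bar> \<le> e * \<bar>u - t\<bar> + e * \<bar>v - t\<bar>"
      using d[of u] d[of v] that by linarith
    also have "\<dots> = e * (v - u)"
      using that by (simp add: algebra_simps)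
    finally show ?thesis .
  qed
  with \<open>0 < d\<close> that show thesis by blast
qed

text \<open>The increment \<open>g b - g a\<close> telescopes over a tagged division, and half of
  the error \<open>e\<close> goes to each kind of tag. Tags outside \<open>N\<close> cost at most
  \<open>\<epsilon>\<close> times the length of their interval. Tags in \<open>N\<close> cost the
  increments of \<open>g\<close> over intervals of total length below \<open>d\<close>.\<close>

theorem has_integral_absolutely_continuous_on_interval:
  fixes g g' :: "real \<Rightarrow> real"
  assumes "a \<le> b" and ac: "absolutely_continuous_on_interval a b g" and N: "negligible N"
    and der: "\<And>t. t \<in> {a..b} - N \<Longrightarrow> (g has_real_derivative g' t) (at t within {a..b})"
  shows "(g' has_integral (g b - g a)) {a..b}"
proof -
  \<comment> \<open>Nothing is known of \<open>g'\<close> on \<open>N\<close>; the value 0 there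
    removes those terms from the Riemann sum, and a spike argument restores \<open>g'\<close> at the
    end.\<close>
  define g0 where "g0 t = (if t \<in> N then 0 else g' t)" for t
  have "(g0 has_integral (g b - g a)) {a..b}"
    unfolding has_integral_real
  proof (intro allI impI)
    fix e :: real assume "0 < e"
    \<comment> \<open>The added 1 avoids a zero denominator when \<open>a = b\<close> and makes
      \<open>\<epsilon> * (b - a) < e / 2\<close> strict.\<close>
    define \<epsilon> where "\<epsilon> = e / (2 * (b - a + 1))"
    have "0 < \<epsilon>" using \<open>0 < e\<close> \<open>a \<le> b\<close> by (simp add: \<epsilon>_def)
    have \<epsilon>: "\<epsilon> * (b - a) < e / 2"
      using \<open>0 < e\<close> \<open>a \<le> b\<close> by (simp add: \<epsilon>_def field_simps)
    obtain d where "0 < d" and d: "\<And>D. D division_of \<Union>D \<Longrightarrow> \<Union>D \<subseteq> {a..b}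
      \<Longrightarrow> (\<Sum>K\<in>D. Sup K - Inf K) < d \<Longrightarrow> (\<Sum>K\<in>D. \<bar>g (Sup K) - g (Inf K)\<bar>) < e / 2"
      using absolutely_continuous_on_intervalD[OF ac half_gt_zero[OF \<open>0 < e\<close>]] by blast
    obtain U where "open U" "N \<subseteq> U" and UN: "U - N \<in> lmeasurable" "emeasure lebesgue (U - N) < ennreal d"
      using sets_lebesgue_outer_open[OF negligible_imp_sets[OF N] \<open>0 < d\<close>] by blast
    \<comment> \<open>The outer approximation bounds only the excess \<open>U - N\<close>; as
      \<open>N\<close> is null, the bound passes to \<open>U\<close>.\<close>
    have U: "U \<in> lmeasurable" "measure lebesgue U < d"
    proof -
      have "U = (U - N) \<union> N" using \<open>N \<subseteq> U\<close> by auto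
      then show "U \<in> lmeasurable"
        by (metis UN(1) N fmeasurable.Un negligible_imp_measurable)
      then have "measure lebesgue (U - N) = measure lebesgue U"
        using N by (simp add: measure_Diff_null_set negligible_iff_null_sets fmeasurableD)
      then show "measure lebesgue U < d"
        using UN \<open>0 < d\<close> by (simp add: emeasure_eq_measure2 ennreal_less_iff)
    qed
    \<comment> \<open>The radius of the gauge at \<open>t\<close>: within \<open>U\<close> for
      points of \<open>N\<close>, from the straddle estimate for other points of
      \<open>{a..b}\<close>, and arbitrary elsewhere.\<close>
    have "\<exists>r>0. (t \<in> N \<longrightarrow> ball t r \<subseteq> U) \<and> (t \<in> {a..b} - N \<longrightarrow> (\<forall>u v. u \<in> {a..b} \<longrightarrow> v \<in> {a..b} \<longrightarrow>
        u \<le> t \<longrightarrow> t \<le> v \<longrightarrow> t - u < r \<longrightarrow> v - t < r \<longrightarrow> \<bar>(v - u) * g' t - (g v - g u)\<bar> \<le> \<epsilon> * (v - u)))" for t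
    proof (cases "t \<in> N")
      case True
      then show ?thesis using \<open>open U\<close> \<open>N \<subseteq> U\<close> by (meson DiffD2 openE subsetD)
    next
      case False
      show ?thesis
      proof (cases "t \<in> {a..b}")
        case True
        then show ?thesis
          using has_real_derivative_straddle[OF der \<open>0 < \<epsilon>\<close>, of t] False by (metis DiffI)
      next
        case False
        then show ?thesis using \<open>t \<notin> N\<close> zero_less_one by blast
      qed
    qed
    then obtain r where r0: "\<And>t. 0 < r t" and rN: "\<And>t. t \<in> N \<Longrightarrow> ball t (r t) \<subseteq> U"
      and r: "\<And>t u v. t \<in> {a..b} - N \<Longrightarrow> u \<in> {a..b} \<Longrightarrow> v \<in> {a..b} \<Longrightarrow> u \<le> t \<Longrightarrow> t \<le> v
        \<Longrightarrow> t - u < r t \<Longrightarrow> v - t < r t \<Longrightarrow> \<bar>(v - u) * g' t - (g v - g u)\<bar> \<le> \<epsilon> * (v - u)"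
      by metis
    show "\<exists>\<gamma>. gauge \<gamma> \<and> (\<forall>p. p tagged_division_of {a..b} \<and> \<gamma> fine p \<longrightarrow>
        norm ((\<Sum>(t, K)\<in>p. measure lborel K *\<^sub>R g0 t) - (g b - g a)) < e)"
    proof (intro exI[of _ "\<lambda>t. ball t (r t)"] conjI allI impI)
      show "gauge (\<lambda>t. ball t (r t))"
        using r0 by (simp add: gauge_ball_dependent)
      fix p assume "p tagged_division_of {a..b} \<and> (\<lambda>t. ball t (r t)) fine p"
      then have p: "p tagged_division_of {a..b}" and fine: "(\<lambda>t. ball t (r t)) fine p" by auto
      have "finite p" using p by blast
      have interval: "\<exists>u v. K = {u..v} \<and> u \<le> t \<and> t \<le> v \<and> a \<le> u \<and> v \<le> b \<and> Inf K = u \<and> Sup K = v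
          \<and> K \<subseteq> ball t (r t)" if tK: "(t, K) \<in> p" for t K
      proof -
        obtain u v where K: "K = {u..v}" "t \<in> K" "K \<subseteq> {a..b}"
          using tagged_division_ofD(2,3,4)[OF p tK] by (metis box_real(2))
        then have "K \<subseteq> ball t (r t)" using fine tK by (auto simp: fine_def)
        with K show ?thesis by force
      qed
      \<comment> \<open>The part of \<open>p\<close> tagged in \<open>N\<close>. Its intervals
        \<open>D\<close> form a division of their union inside \<open>U\<close>, so their total
        length is below \<open>d\<close>.\<close>
      define q where "q = {(t, K) \<in> p. t \<in> N}"
      define D where "D = snd ` q"
      have "p tagged_partial_division_of {a..b}"
        using p unfolding tagged_division_of_def by (rule conjunct1)
      moreover have "q \<subseteq> p" by (auto simp: q_def)
      ultimately have q: "q tagged_partial_division_of {a..b}"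
        by (rule tagged_partial_division_subset)
      have D: "D division_of \<Union>D"
        unfolding D_def by (rule partial_division_of_tagged_division[OF q])
      have "K \<subseteq> U" "K \<subseteq> {a..b}" if "K \<in> D" for K
      proof -
        obtain t where "(t, K) \<in> p" "t \<in> N" using \<open>K \<in> D\<close> by (auto simp: D_def q_def)
        then show "K \<subseteq> U" "K \<subseteq> {a..b}"
          using interval[of t K] rN[of t] tagged_division_ofD(3)[OF p, of t K] by auto
      qed
      then have DU: "\<Union>D \<subseteq> U" "\<Union>D \<subseteq> {a..b}" by blast+
      have "(\<Sum>K\<in>D. Sup K - Inf K) = (\<Sum>K\<in>D. measure lebesgue K)"
        by (rule sum.cong) (simp_all add: content_division_of_real_interval[OF D])
      also have "\<dots> = measure lebesgue (\<Union>D)" by (rule content_division[OF D])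
      also have "\<dots> \<le> measure lebesgue U"
        using DU U lmeasurable_division[OF D] by (intro measure_mono_fmeasurable) auto
      also have "\<dots> < d" by (rule U)
      finally have Dsmall: "(\<Sum>K\<in>D. \<bar>g (Sup K) - g (Inf K)\<bar>) < e / 2"
        using d[OF D DU(2)] by simp
      \<comment> \<open>Forgetting tags need not be injective, but an interval carrying two tags has
        empty interior, hence is a single point with increment 0.\<close>
      have "(\<Sum>K\<in>snd ` q. \<bar>g (Sup K) - g (Inf K)\<bar>) = (\<Sum>(t, K)\<in>q. \<bar>g (Sup K) - g (Inf K)\<bar>)"
      proof (subst sum.reindex_nontrivial)
        show "finite q" using \<open>finite p\<close> \<open>q \<subseteq> p\<close> by (rule finite_subset[rotated])
        fix z z' assume z: "z \<in> q" "z' \<in> q" "z \<noteq> z'" "snd z = snd z'"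
        then have "z \<in> p" "z' \<in> p" using \<open>q \<subseteq> p\<close> by auto
        with z have "(fst z, snd z) \<in> p" "(fst z', snd z) \<in> p" "(fst z, snd z) \<noteq> (fst z', snd z)"
          by (metis prod.collapse)+
        then have "interior (snd z) = {}" "\<exists>u v. snd z = {u..v} \<and> u \<le> v"
          using tagged_division_ofD(5)[OF p] interval by (metis inf.idem, meson order_trans)
        then show "\<bar>g (Sup (snd z)) - g (Inf (snd z))\<bar> = 0" by auto
      qed (simp add: o_def split_def)
      with Dsmall have qsmall: "(\<Sum>(t, K)\<in>q. \<bar>g (Sup K) - g (Inf K)\<bar>) < e / 2" by (simp add: D_def)
      have sums: "(\<Sum>(t, K)\<in>p. g (Sup K) - g (Inf K)) = g b - g a"
          "(\<Sum>(t, K)\<in>p. Sup K - Inf K) = b - a"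
        using additive_tagged_division_1[OF \<open>a \<le> b\<close> p, of g]
          additive_tagged_division_1[OF \<open>a \<le> b\<close> p, of "\<lambda>t. t"] by auto
      have "norm ((\<Sum>(t, K)\<in>p. measure lborel K *\<^sub>R g0 t) - (g b - g a))
          = \<bar>\<Sum>(t, K)\<in>p. measure lborel K * g0 t - (g (Sup K) - g (Inf K))\<bar>"
        unfolding sums(1)[symmetric] by (simp add: sum_subtractf split_def)
      also have "\<dots> \<le> (\<Sum>(t, K)\<in>p. \<epsilon> * (Sup K - Inf K) + (if t \<in> N then \<bar>g (Sup K) - g (Inf K)\<bar> else 0))"
      proof (rule order_trans[OF sum_abs sum_mono], clarsimp simp del: box_real)
        fix t K assume tK: "(t, K) \<in> p"
        then obtain u v where K: "K = {u..v}" "u \<le> t" "t \<le> v" "a \<le> u" "v \<le> b" "Inf K = u" "Sup K = v"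
            "K \<subseteq> ball t (r t)"
          using interval by blast
        then have "u \<in> K" "v \<in> K" by simp_all
        then have "u \<in> ball t (r t)" "v \<in> ball t (r t)" using K(8) by blast+
        then have "t - u < r t" "v - t < r t" by (auto simp: dist_real_def)
        then have "\<bar>(v - u) * g' t - (g v - g u)\<bar> \<le> \<epsilon> * (v - u)" if "t \<notin> N"
          using r[of t u v] K that by auto
        then show "(t \<in> N \<longrightarrow> \<bar>measure lborel K * g0 t - (g (Sup K) - g (Inf K))\<bar>
              \<le> \<epsilon> * (Sup K - Inf K) + \<bar>g (Sup K) - g (Inf K)\<bar>) \<and>
            (t \<notin> N \<longrightarrow> \<bar>measure lborel K * g0 t - (g (Sup K) - g (Inf K))\<bar> \<le> \<epsilon> * (Sup K - Inf K))"
          using K \<open>0 < \<epsilon>\<close> by (auto simp: g0_def abs_minus_commute)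
      qed
      also have "\<dots> = \<epsilon> * (\<Sum>(t, K)\<in>p. Sup K - Inf K)
          + (\<Sum>(t, K)\<in>p. if t \<in> N then \<bar>g (Sup K) - g (Inf K)\<bar> else 0)"
        by (simp add: sum.distrib sum_distrib_left split_def)
      also have "(\<Sum>(t, K)\<in>p. if t \<in> N then \<bar>g (Sup K) - g (Inf K)\<bar> else 0)
          = (\<Sum>(t, K)\<in>q. \<bar>g (Sup K) - g (Inf K)\<bar>)"
        using \<open>finite p\<close> \<open>q \<subseteq> p\<close> by (intro sum.mono_neutral_cong_right) (auto simp: q_def split: if_splits)
      finally show "norm ((\<Sum>(t, K)\<in>p. measure lborel K *\<^sub>R g0 t) - (g b - g a)) < e"
        using qsmall \<epsilon> by (simp add: sums(2))
    qed
  qed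
  then show ?thesis
    by (rule has_integral_spike[OF N, rotated]) (simp add: g0_def)
qed

section \<open>Absolute integrability of the derivative\<close>

text \<open>Upgrades gauge integrability to Lebesgue integrability. On an interval shorter than the
  \<open>d\<close> for tolerance 1, the integrals of \<open>g'\<close> over the members of a
  division are increments of \<open>g\<close>, with absolute values summing to less than 1. Bounded
  variation then gives absolute integrability, and short intervals are glued together.\<close>

theorem absolutely_integrable_absolutely_continuous_on_interval:
  fixes g g' :: "real \<Rightarrow> real"
  assumes "a \<le> b" and ac: "absolutely_continuous_on_interval a b g" and N: "negligible N"
    and der: "\<And>t. t \<in> {a..b} - N \<Longrightarrow> (g has_real_derivative g' t) (at t within {a..b})"
  shows "g' absolutely_integrable_on {a..b}"
proof -
  have ftc: "(g' has_integral (g v - g u)) {u..v}" if "u \<le> v" "{u..v} \<subseteq> {a..b}" for u v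
  proof (rule has_integral_absolutely_continuous_on_interval[OF that(1) _ N])
    show "absolutely_continuous_on_interval u v g"
      by (rule absolutely_continuous_on_interval_subset[OF ac that(2)])
    show "(g has_real_derivative g' t) (at t within {u..v})" if "t \<in> {u..v} - N" for t
      using der[of t] that \<open>{u..v} \<subseteq> {a..b}\<close> by (blast intro: DERIV_subset)
  qed
  obtain d where "0 < d" and d: "\<And>D. D division_of \<Union>D \<Longrightarrow> \<Union>D \<subseteq> {a..b}
      \<Longrightarrow> (\<Sum>K\<in>D. Sup K - Inf K) < d \<Longrightarrow> (\<Sum>K\<in>D. \<bar>g (Sup K) - g (Inf K)\<bar>) < 1"
    using absolutely_continuous_on_intervalD[OF ac zero_less_one] by blast
  have short: "g' absolutely_integrable_on {u..v}"
    if "u \<le> v" "{u..v} \<subseteq> {a..b}" "v - u < d" for u v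
    unfolding box_real(2)[symmetric]
  proof (rule bounded_variation_absolutely_integrable_interval[where B = 1])
    show "g' integrable_on cbox u v"
      using ftc[OF that(1,2)] by (auto simp: integrable_on_def)
    fix D assume D: "D division_of cbox u v"
    then have UD: "\<Union>D = {u..v}" by (metis box_real(2) division_ofD(6))
    have DU: "D division_of \<Union>D" using D UD by simp
    have "(\<Sum>K\<in>D. Sup K - Inf K) = (\<Sum>K\<in>D. measure lborel K)"
      by (rule sum.cong) (simp_all add: content_division_of_real_interval[OF DU])
    also have "\<dots> = v - u"
      using additive_content_division[OF D] \<open>u \<le> v\<close> by simp
    finally have "(\<Sum>K\<in>D. \<bar>g (Sup K) - g (Inf K)\<bar>) < 1"
      using d[OF DU] UD that by simp
    moreover have "norm (integral K g') = \<bar>g (Sup K) - g (Inf K)\<bar>" if KD: "K \<in> D" for K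
    proof -
      obtain s t where K: "s \<le> t" "K = {s..t}" "Inf K = s" "Sup K = t" "s \<in> {u..v}" "t \<in> {u..v}"
        using division_of_real_interval_cases[OF DU KD] UD by metis
      then have "(g' has_integral (g t - g s)) {s..t}"
        using \<open>{u..v} \<subseteq> {a..b}\<close> by (intro ftc) auto
      then show ?thesis using K by (simp add: integral_unique)
    qed
    ultimately show "(\<Sum>K\<in>D. norm (integral K g')) \<le> 1" by simp
  qed
  \<comment> \<open>The containment is part of the predicate because the local case of
    \<open>Bolzano\<close> also covers intervals reaching outside \<open>{a..b}\<close>.\<close>
  have "u \<le> v \<longrightarrow> {u..v} \<subseteq> {a..b} \<longrightarrow> g' absolutely_integrable_on {u..v}" if "u \<le> v" for u v
    using that
  proof (induction rule: Bolzano)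
    case (trans u v w)
    have "g' absolutely_integrable_on {u..w}" if "{u..w} \<subseteq> {a..b}"
    proof (rule absolutely_integrable_on_combine)
      show "g' absolutely_integrable_on {u..v}" "g' absolutely_integrable_on {v..w}"
        using trans that by (simp_all add: subset_iff)
    qed fact+
    then show ?case by blast
  next
    case (local t)
    then show ?case using \<open>0 < d\<close> short by blast
  qed
  with \<open>a \<le> b\<close> show ?thesis by blast
qed

section \<open>Integration by parts and the kernel identity\<close>

text \<open>Two integrations by parts, with a free centre \<open>c\<close> so that both branches of
  the kernel are covered. Only the first, which involves \<open>f''\<close>, needs the theorem for
  absolutely continuous functions.\<close>

lemma has_integral_square_times_second_derivative:
  fixes f f' f'' :: "real \<Rightarrow> real"
  assumes "u \<le> v" and f: "\<And>t. t \<in> {u..v} \<Longrightarrow> (f has_real_derivative f' t) (at t within {u..v})"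
    and ac: "absolutely_continuous_on_interval u v f'" and N: "negligible N"
    and f': "\<And>t. t \<in> {u..v} - N \<Longrightarrow> (f' has_real_derivative f'' t) (at t within {u..v})"
  shows "(\<lambda>t. (t - c)\<^sup>2 * f'' t) absolutely_integrable_on {u..v}"
    and "((\<lambda>t. (t - c)\<^sup>2 * f'' t) has_integral
      ((v - c)\<^sup>2 * f' v - (u - c)\<^sup>2 * f' u - 2 * ((v - c) * f v - (u - c) * f u)
        + 2 * integral {u..v} f)) {u..v}"
proof -
  \<comment> \<open>The square is written as a product so that the closure lemmas for products and
    shifts apply directly.\<close>
  define G where "G t = (t - c) * (t - c) * f' t" for t
  define G' where "G' t = 2 * (t - c) * f' t + (t - c)\<^sup>2 * f'' t" for t
  have G: "absolutely_continuous_on_interval u v G"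
    unfolding G_def
    by (intro absolutely_continuous_on_interval_mult absolutely_continuous_on_interval_shift ac)
  have G': "(G has_real_derivative G' t) (at t within {u..v})" if "t \<in> {u..v} - N" for t
    unfolding G_def G'_def
    by (rule derivative_eq_intros f'[OF that] refl | simp add: power2_eq_square algebra_simps)+
  have cf: "continuous_on {u..v} f"
    using f by (meson DERIV_continuous continuous_on_eq_continuous_within)
  have cf': "continuous_on {u..v} f'"
    by (rule absolutely_continuous_on_interval_imp_continuous_on[OF ac])
  \<comment> \<open>This summand of \<open>G'\<close> is continuous; subtracting it from
    \<open>G'\<close> isolates the term with \<open>f''\<close>.\<close>
  have "(\<lambda>t. 2 * (t - c) * f' t) absolutely_integrable_on {u..v}"
    by (intro absolutely_integrable_continuous_real continuous_intros cf')
  from set_integral_diff(1)[OF absolutely_integrable_absolutely_continuous_on_interval[OF \<open>u \<le> v\<close> G N G'] this]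
  show "(\<lambda>t. (t - c)\<^sup>2 * f'' t) absolutely_integrable_on {u..v}"
    by (simp add: G'_def)
  have "((\<lambda>t. f t + (t - c) * f' t) has_integral ((v - c) * f v - (u - c) * f u)) {u..v}"
  proof (rule fundamental_theorem_of_calculus[OF \<open>u \<le> v\<close>])
    fix t assume "t \<in> {u..v}"
    show "((\<lambda>t. (t - c) * f t) has_vector_derivative f t + (t - c) * f' t) (at t within {u..v})"
      unfolding has_real_derivative_iff_has_vector_derivative[symmetric]
      by (rule derivative_eq_intros f[OF \<open>t \<in> {u..v}\<close>] refl | simp)+
  qed
  from has_integral_mult_right[OF has_integral_diff[OF this
        integrable_integral[OF integrable_continuous_real[OF cf]]], of 2]
  have "((\<lambda>t. 2 * (t - c) * f' t) has_integral
      2 * ((v - c) * f v - (u - c) * f u - integral {u..v} f)) {u..v}"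
    by (simp only: mult.assoc add_diff_cancel_left')
  from has_integral_diff[OF has_integral_absolutely_continuous_on_interval[OF \<open>u \<le> v\<close> G N G'] this]
  show "((\<lambda>t. (t - c)\<^sup>2 * f'' t) has_integral
      ((v - c)\<^sup>2 * f' v - (u - c)\<^sup>2 * f' u - 2 * ((v - c) * f v - (u - c) * f u)
        + 2 * integral {u..v} f)) {u..v}"
    by (simp add: G_def G'_def power2_eq_square algebra_simps)
qed

text \<open>Absolute continuity of \<open>f\<close> alone yields no second derivative; here
  \<open>f'\<close> is absolutely continuous and \<open>f''\<close> is its derivative almost
  everywhere. Asserting integrability as well ensures that the integral on the left is not a default
  value.\<close>

theorem lemma4:
  fixes a b \<alpha> \<beta> h x :: real and f f' f'' :: "real \<Rightarrow> real"
  assumes "a < b"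
    and "absolutely_continuous_on_interval a b f"
    and "\<And>t. t \<in> {a..b} \<Longrightarrow> (f has_real_derivative f' t) (at t within {a..b})"
    and "absolutely_continuous_on_interval a b f'"
    and "AE t in lebesgue. t \<in> {a..b} \<longrightarrow>
           (f' has_real_derivative f'' t) (at t within {a..b})"
    and "\<alpha> \<ge> 0" and "\<beta> \<ge> 0" and "\<not> (\<alpha> = 0 \<and> \<beta> = 0)"
    and "h \<in> {0..1}"
    and "x \<in> {a + h * ((b - a) / 2)..b - h * ((b - a) / 2)}"
  shows "set_integrable lebesgue {a..b} (\<lambda>t. peano_kernel a b \<alpha> \<beta> h x t * f'' t) \<and>
    (LINT t:{a..b}|lebesgue. peano_kernel a b \<alpha> \<beta> h x t * f'' t) =
      1 / (2 * (\<alpha> + \<beta>)) *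
        (\<alpha> / (x - a) * (x - (a + h * ((b - a) / 2)))\<^sup>2
          - \<beta> / (b - x) * (x - (b - h * ((b - a) / 2)))\<^sup>2) * f' x
      - 1 / (\<alpha> + \<beta>) *
        (\<alpha> / (x - a) * (x - (a + h * ((b - a) / 2)))
          - \<beta> / (b - x) * (x - (b - h * ((b - a) / 2)))) * f x
      - 1 / (\<alpha> + \<beta>) * h * ((b - a) / 2) *
        (\<alpha> / (x - a) * f a + \<beta> / (b - x) * f b)
      + 1 / (\<alpha> + \<beta>) * h\<^sup>2 * ((b - a)\<^sup>2 / 8) *
        (\<beta> / (b - x) * f' b - \<alpha> / (x - a) * f' a)
      + 1 / (\<alpha> + \<beta>) *
        (\<alpha> / (x - a) * (LINT t:{a..x}|lebesgue. f t)
          + \<beta> / (b - x) * (LINT t:{x..b}|lebesgue. f t))"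
proof -
  define c1 c2 where c: "c1 = a + h * ((b - a) / 2)" "c2 = b - h * ((b - a) / 2)"
  \<comment> \<open>The computation is linear in \<open>A\<close> and \<open>B\<close>, which stay
    opaque. The cases \<open>x = a\<close> and \<open>x = b\<close>, where one of them is 0 by
    convention, thus need no separate treatment.\<close>
  define A B s where AB: "A = \<alpha> / (x - a)" "B = \<beta> / (b - x)" "s = 1 / (\<alpha> + \<beta>)"
  have "0 \<le> h * ((b - a) / 2)" using assms(1,9) by simp
  then have x: "a \<le> x" "x \<le> b" using assms(10) by auto
  obtain N where N: "negligible N"
    and f'': "\<And>t. t \<in> {a..b} - N \<Longrightarrow> (f' has_real_derivative f'' t) (at t within {a..b})"
    using assms(5) unfolding eventually_ae_filter_negligible by blast
  have sub: "{a..x} \<subseteq> {a..b}" "{x..b} \<subseteq> {a..b}" using x by auto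
  let ?Q = "\<lambda>t. peano_kernel a b \<alpha> \<beta> h x t * f'' t"
  have f: "continuous_on {a..b} f"
    using assms(3) by (meson DERIV_continuous continuous_on_eq_continuous_within)
  have LINT_f: "(LINT t:{u..v}|lebesgue. f t) = integral {u..v} f" if "{u..v} \<subseteq> {a..b}" for u v
    by (intro set_lebesgue_integral_eq_integral absolutely_integrable_continuous_real
        continuous_on_subset[OF f that])
  have side: "(\<lambda>t. (t - c)\<^sup>2 * f'' t) absolutely_integrable_on {u..v}"
      "((\<lambda>t. (t - c)\<^sup>2 * f'' t) has_integral
        ((v - c)\<^sup>2 * f' v - (u - c)\<^sup>2 * f' u - 2 * ((v - c) * f v - (u - c) * f u)
          + 2 * integral {u..v} f)) {u..v}"
    if "u \<le> v" "{u..v} \<subseteq> {a..b}" for c u v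
  proof -
    have "(f has_real_derivative f' t) (at t within {u..v})" if "t \<in> {u..v}" for t
      using DERIV_subset[OF assms(3)] that \<open>{u..v} \<subseteq> {a..b}\<close> by blast
    moreover have "absolutely_continuous_on_interval u v f'"
      by (rule absolutely_continuous_on_interval_subset[OF assms(4) that(2)])
    moreover have "(f' has_real_derivative f'' t) (at t within {u..v})" if "t \<in> {u..v} - N" for t
      using DERIV_subset[OF f''] that \<open>{u..v} \<subseteq> {a..b}\<close> by blast
    ultimately show "(\<lambda>t. (t - c)\<^sup>2 * f'' t) absolutely_integrable_on {u..v}"
      "((\<lambda>t. (t - c)\<^sup>2 * f'' t) has_integral
        ((v - c)\<^sup>2 * f' v - (u - c)\<^sup>2 * f' u - 2 * ((v - c) * f v - (u - c) * f u)
          + 2 * integral {u..v} f)) {u..v}"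
      using has_integral_square_times_second_derivative[OF that(1) _ _ N] by blast+
  qed
  \<comment> \<open>The set differences match the spike rules. At \<open>t = x\<close> the kernel
    takes its left branch, so only the right formula must exclude that point.\<close>
  have left: "?Q t = s * A / 2 * ((t - c1)\<^sup>2 * f'' t)" if "t \<in> {a..x} - {}" for t
    using that by (simp add: peano_kernel_def c AB)
  have right: "?Q t = s * B / 2 * ((t - c2)\<^sup>2 * f'' t)" if "t \<in> {x..b} - {x}" for t
    using that by (simp add: peano_kernel_def c AB)
  have "?Q absolutely_integrable_on {a..x}"
    by (rule absolutely_integrable_spike[OF _ negligible_empty left])
      (intro set_integrable_mult_right side x sub)
  moreover have "?Q absolutely_integrable_on {x..b}"
    by (rule absolutely_integrable_spike[OF _ negligible_sing right])
      (intro set_integrable_mult_right side x sub)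
  ultimately have int: "set_integrable lebesgue {a..b} ?Q"
    by (rule absolutely_integrable_on_combine) (use x in auto)
  have "(?Q has_integral
      (s * A / 2 * ((x - c1)\<^sup>2 * f' x - (a - c1)\<^sup>2 * f' a - 2 * ((x - c1) * f x - (a - c1) * f a)
          + 2 * integral {a..x} f)
     + s * B / 2 * ((b - c2)\<^sup>2 * f' b - (x - c2)\<^sup>2 * f' x - 2 * ((b - c2) * f b - (x - c2) * f x)
          + 2 * integral {x..b} f))) {a..b}" (is "(_ has_integral ?I) _")
    by (intro has_integral_combine[OF x]
        has_integral_spike[OF negligible_empty left has_integral_mult_right]
        has_integral_spike[OF negligible_sing right has_integral_mult_right] side x sub)
  then have "(LINT t:{a..b}|lebesgue. ?Q t) = ?I"
    by (simp add: set_lebesgue_integral_eq_integral(2)[OF int] integral_unique)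
  \<comment> \<open>Since \<open>a - c1\<close> and \<open>b - c2\<close> are
    \<open>h * ((b - a) / 2)\<close> up to sign, the endpoint terms give the values of
    \<open>f\<close> and \<open>f'\<close> at \<open>a\<close> and \<open>b\<close>; half the square
    of that quantity is the source of the 8.\<close>
  also have "\<dots> = s / 2 * (A * (x - c1)\<^sup>2 - B * (x - c2)\<^sup>2) * f' x
      - s * (A * (x - c1) - B * (x - c2)) * f x
      - s * h * ((b - a) / 2) * (A * f a + B * f b)
      + s * h\<^sup>2 * ((b - a)\<^sup>2 / 8) * (B * f' b - A * f' a)
      + s * (A * integral {a..x} f + B * integral {x..b} f)"
    by (simp add: c power2_eq_square field_simps)
  finally have eq: "(LINT t:{a..b}|lebesgue. ?Q t) = \<dots>" .
  have half: "1 / (2 * (\<alpha> + \<beta>)) = s / 2" by (simp add: AB)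
  show ?thesis
    unfolding half c[symmetric] AB[symmetric] LINT_f[OF sub(1)] LINT_f[OF sub(2)]
    using int eq by blast
qed

end
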